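(* Let $N$ be a finite set with $|N|\geq 2$, let $\eta=(\eta(i|B))_{i\in N,\,B\subseteq N\setminus\{i\}}$ be a real vector satisfying $\sum_{B\subseteq N\setminus\{j\}}\eta(j|B)=1$ for all $j\in N$, and let $u=u^{\eta}$ and $c$ be the vectors in $\mathbb{R}^{\mathcal{P}(N)}$ ascribed to $\eta$, where $c(S)=1-\sum_{T,\,S\subseteq T\subseteq N}u(T)$ for $S\subseteq N$. Then for every $C\subseteq N$ with $|C|\geq 2$, the cluster inequality $$1\leq\sum_{i\in C}\ \sum_{B\subseteq N\setminus\{i\},\,B\cap C=\emptyset}\eta(i|B)$$ can be equivalently re-written in terms of $u$ as $$\sum_{T\subseteq N,\,|C\cap T|\geq 2}u(T)\cdot(|C\cap T|-1)\geq 0,$$ and also equivalently in terms of $c$ as $$|C|-1-\sum_{S\subseteq C,\,|S|\geq 2}c(S)\cdot(-1)^{|S|}\geq 0.$$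
   Context: $\mathcal{P}(N)$ is the power set of $N$. For $A\subseteq N$, $\delta_A(S)=1$ if $S=A$ and $\delta_A(S)=0$ for $S\subseteq N$, $S\neq A$. For a vector $\eta=(\eta(i|B))_{i\in N,\,B\subseteq N\setminus\{i\}}$, the vector $u^{\eta}\in\mathbb{R}^{\mathcal{P}(N)}$ is given for $T\subseteq N$ by $$u^{\eta}(T)=\delta_N(T)-\delta_{\emptyset}(T)+\sum_{i\in N}\sum_{B\subseteq N\setminus\{i\}}\eta(i|B)\cdot\{\delta_B(T)-\delta_{\{i\}\cup B}(T)\}.$$ *)

theory Defs
  imports Complex_Main
begin

text \<open>
  A vector indexed by the subsets of \<open>N\<close> is a function \<open>'a set \<Rightarrow> real\<close>, and a vector with components
  \<open>\<eta>(i|B)\<close> is a function \<open>\<eta> :: 'a \<Rightarrow> 'a set \<Rightarrow> real\<close>; only the values at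
  \<open>i \<in> N\<close> and \<open>B \<subseteq> N - {i}\<close> (at subsets of \<open>N\<close>, respectively) are meaningful.
\<close>

definition delta :: "'a set \<Rightarrow> 'a set \<Rightarrow> real" where
  "delta A S = (if S = A then 1 else 0)"

definition u_vec :: "'a set \<Rightarrow> ('a \<Rightarrow> 'a set \<Rightarrow> real) \<Rightarrow> 'a set \<Rightarrow> real" where
  "u_vec N \<eta> T = delta N T - delta {} T +
     (\<Sum>i\<in>N. \<Sum>B\<in>Pow (N - {i}). \<eta> i B * (delta B T - delta ({i} \<union> B) T))"

definition c_vec :: "'a set \<Rightarrow> ('a set \<Rightarrow> real) \<Rightarrow> 'a set \<Rightarrow> real" where
  "c_vec N u S = 1 - (\<Sum>T | S \<subseteq> T \<and> T \<subseteq> N. u T)"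

end

theory Submission
  imports Defs
begin

text \<open>
  For a non-empty cluster \<open>C\<close>, the two equivalences come from identities between the slacks of the three
  inequalities: each slack equals the linear functional of \<open>u\<close> with coefficients \<open>w T = max (card (C \<inter> T) - 1) 0\<close>. Below, \<open>w T\<close> is the truncated difference
  \<open>card (C \<inter> T) - 1\<close> on the naturals, so that the sum may range over all \<open>T \<subseteq> N\<close>.

  In terms of \<open>\<eta>\<close> (lemma \<open>cluster_sum_u\<close>): pairing \<open>u\<close> with any function \<open>f\<close> of sets
  turns each generator \<open>\<delta>\<^sub>B - \<delta>\<^bsub>{i} \<union> B\<^esub>\<close> into the difference
  \<open>f B - f ({i} \<union> B)\<close>. For \<open>f = w\<close> this difference is \<open>-1\<close> if \<open>i \<in> C\<close> and \<open>B\<close> meets \<open>C\<close>, and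
  \<open>0\<close> otherwise. The functional is thus \<open>card C - 1\<close> minus the total weight \<open>\<eta> i B\<close> of the pairs
  with \<open>i \<in> C\<close> and \<open>B\<close> meeting \<open>C\<close>. Since the weights of each \<open>i\<close> add up to \<open>1\<close>, this is the
  total weight of the pairs with \<open>i \<in> C\<close> and \<open>B\<close> disjoint from \<open>C\<close>, minus \<open>1\<close>.

  In terms of \<open>c\<close> (lemma \<open>cluster_sum_c\<close>): \<open>w\<close> is also an alternating sum,
  \<open>w T = (\<Sum>S | S \<subseteq> C \<inter> T \<and> card S \<ge> 2. (- 1) ^ card S)\<close>, by lemma \<open>alternating_sum_card_ge_2\<close>.
  Inserting this into the functional and exchanging the sums over \<open>T\<close> and \<open>S\<close> collects, for
  each \<open>S\<close>, exactly the superset sum \<open>1 - c S\<close>; the case \<open>T = N\<close> of the same alternating sum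
  evaluates the contribution of the constants \<open>1\<close> to \<open>card C - 1\<close>.
\<close>

lemma sum_delta_mult:
  fixes f :: "'a set \<Rightarrow> real"
  assumes "finite N" "A \<subseteq> N"
  shows "(\<Sum>T\<in>Pow N. delta A T * f T) = f A"
proof -
  have "(\<Sum>T\<in>Pow N. delta A T * f T) = (\<Sum>T\<in>Pow N. if T = A then f T else 0)"
    by (rule sum.cong) (auto simp: delta_def)
  then show ?thesis using assms by simp
qed

text \<open>
  Pairing with \<open>u_vec N \<eta>\<close> replaces each point mass by evaluation, which turns any linear
  functional of \<open>u\<close> into an affine one of \<open>\<eta>\<close>.
\<close>

lemma sum_u_vec_mult:
  fixes f :: "'a set \<Rightarrow> real"
  assumes "finite N"
  shows "(\<Sum>T\<in>Pow N. u_vec N \<eta> T * f T) =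
    f N - f {} + (\<Sum>i\<in>N. \<Sum>B\<in>Pow (N - {i}). \<eta> i B * (f B - f (insert i B)))"
proof -
  have "(\<Sum>T\<in>Pow N. u_vec N \<eta> T * f T) =
      (\<Sum>T\<in>Pow N. delta N T * f T) - (\<Sum>T\<in>Pow N. delta {} T * f T) +
      (\<Sum>T\<in>Pow N. \<Sum>i\<in>N. \<Sum>B\<in>Pow (N - {i}).
         \<eta> i B * (delta B T * f T - delta (insert i B) T * f T))"
    by (simp add: u_vec_def distrib_right left_diff_distrib sum.distrib sum_subtractf
        sum_distrib_right mult.assoc)
  also have "(\<Sum>T\<in>Pow N. \<Sum>i\<in>N. \<Sum>B\<in>Pow (N - {i}).
         \<eta> i B * (delta B T * f T - delta (insert i B) T * f T)) =
      (\<Sum>i\<in>N. \<Sum>B\<in>Pow (N - {i}). \<Sum>T\<in>Pow N.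
         \<eta> i B * (delta B T * f T - delta (insert i B) T * f T))"
    by (subst sum.swap, rule sum.cong[OF refl], rule sum.swap)
  also have "\<dots> = (\<Sum>i\<in>N. \<Sum>B\<in>Pow (N - {i}). \<eta> i B * (f B - f (insert i B)))"
  proof (intro sum.cong refl)
    fix i B assume "i \<in> N" "B \<in> Pow (N - {i})"
    then have "B \<subseteq> N" "insert i B \<subseteq> N" by auto
    then show "(\<Sum>T\<in>Pow N. \<eta> i B * (delta B T * f T - delta (insert i B) T * f T)) =
        \<eta> i B * (f B - f (insert i B))"
      using \<open>finite N\<close> by (simp add: sum_distrib_left[symmetric] sum_subtractf sum_delta_mult)
  qed
  finally show ?thesis
    using \<open>finite N\<close> by (simp add: sum_delta_mult)
qed

text \<open>
  The full alternating sum over the subsets of a non-empty set vanishes; the empty set and the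
  singletons contribute \<open>1 - card A\<close> to it. For empty \<open>A\<close> the truncated
  subtraction gives the right value \<open>0\<close>.
\<close>

lemma alternating_sum_card_ge_2:
  fixes A :: "'a set"
  assumes "finite A"
  shows "(\<Sum>S | S \<subseteq> A \<and> card S \<ge> 2. (- 1) ^ card S) = real (card A - 1)"
proof (cases "A = {}")
  case True
  then have "{S. S \<subseteq> A \<and> card S \<ge> 2} = {}" by auto
  then show ?thesis using True by (simp only: sum.empty) simp
next
  case False
  let ?sgn = "\<lambda>S :: 'a set. (- 1 :: real) ^ card S"
  let ?small = "insert {} ((\<lambda>x. {x}) ` A)"
  let ?big = "{S. S \<subseteq> A \<and> card S \<ge> 2}"
  have "S \<in> ?small" if "S \<subseteq> A" "\<not> card S \<ge> 2" for S
  proof -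
    have "finite S" using that assms finite_subset by blast
    then have "S = {} \<or> (\<exists>x. S = {x})"
      using that by (metis One_nat_def card_1_singletonE card_eq_0_iff less_2_cases not_le)
    then show ?thesis using that by auto
  qed
  then have "Pow A = ?small \<union> ?big" by auto
  then have "sum ?sgn (Pow A) = sum ?sgn ?small + sum ?sgn ?big"
    using assms by (simp only:) (rule sum.union_disjoint, auto)
  moreover have "sum ?sgn ?small = 1 - real (card A)"
    using assms by (subst sum.insert) (auto simp: sum.reindex inj_on_def)
  moreover have "sum ?sgn (Pow A) = 0"
  proof (rule sum_alternating_cancels)
    have "{} \<subset> A" using False by auto
    from card_subsupersets_even_odd[OF assms this]
    show "card {S \<in> Pow A. even (card S)} = card {S \<in> Pow A. odd (card S)}"
      by simp
  qed (use assms in simp)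
  moreover have "card A \<ge> 1"
    using False assms by (simp add: Suc_le_eq card_gt_0_iff)
  ultimately show ?thesis by simp
qed

text \<open>
  Adding \<open>i \<in> C - B\<close> to \<open>B\<close> increases \<open>card (C \<inter> B) - 1\<close> by one, except when \<open>B\<close> is disjoint
  from \<open>C\<close>: then the truncation keeps the value at \<open>0\<close>.
\<close>

lemma cluster_sum_u:
  assumes "finite N" "C \<subseteq> N" "C \<noteq> {}"
    and "\<And>j. j \<in> C \<Longrightarrow> (\<Sum>B\<in>Pow (N - {j}). \<eta> j B) = 1"
  shows "(\<Sum>T\<in>Pow N. u_vec N \<eta> T * real (card (C \<inter> T) - 1)) =
    (\<Sum>i\<in>C. \<Sum>B | B \<subseteq> N - {i} \<and> B \<inter> C = {}. \<eta> i B) - 1"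
proof -
  have fC: "finite C" using assms finite_subset by blast
  let ?f = "\<lambda>T. real (card (C \<inter> T) - 1)"
  have step: "?f B - ?f (insert i B) = (if i \<in> C then (if B \<inter> C = {} then 1 else 0) - 1 else 0)"
    if "B \<subseteq> N - {i}" for i B
  proof (cases "i \<in> C")
    case True
    have "i \<notin> C \<inter> B" using that by auto
    then have "card (C \<inter> insert i B) = Suc (card (C \<inter> B))"
      using True fC by simp
    moreover have "card (C \<inter> B) = 0 \<longleftrightarrow> B \<inter> C = {}"
      using fC by (auto simp: card_eq_0_iff)
    ultimately show ?thesis using True by (cases "card (C \<inter> B)") auto
  qed simp
  have inner: "(\<Sum>B\<in>Pow (N - {i}). \<eta> i B * (?f B - ?f (insert i B))) =
      (if i \<in> C then (\<Sum>B | B \<subseteq> N - {i} \<and> B \<inter> C = {}. \<eta> i B) - 1 else 0)" for i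
  proof -
    have "(\<Sum>B\<in>Pow (N - {i}). \<eta> i B * (?f B - ?f (insert i B))) =
        (\<Sum>B\<in>Pow (N - {i}). if i \<in> C then (if B \<inter> C = {} then \<eta> i B else 0) - \<eta> i B else 0)"
    proof (rule sum.cong[OF refl])
      fix B assume "B \<in> Pow (N - {i})"
      then show "\<eta> i B * (?f B - ?f (insert i B)) =
          (if i \<in> C then (if B \<inter> C = {} then \<eta> i B else 0) - \<eta> i B else 0)"
        by (subst step) auto
    qed
    also have "\<dots> = (if i \<in> C then
        (\<Sum>B | B \<in> Pow (N - {i}) \<and> B \<inter> C = {}. \<eta> i B) - (\<Sum>B\<in>Pow (N - {i}). \<eta> i B) else 0)"
      using assms(1) by (simp add: sum_subtractf sum.inter_filter[symmetric] Pow_def)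
    finally show ?thesis using assms(4) by simp
  qed
  have "(\<Sum>i\<in>N. if i \<in> C then (\<Sum>B | B \<subseteq> N - {i} \<and> B \<inter> C = {}. \<eta> i B) - 1 else 0) =
      (\<Sum>i\<in>C. (\<Sum>B | B \<subseteq> N - {i} \<and> B \<inter> C = {}. \<eta> i B) - 1)"
    using assms(1,2) by (simp add: sum.If_cases Int_absorb1)
  moreover have "card C \<ge> 1"
    using \<open>C \<noteq> {}\<close> fC by (simp add: Suc_le_eq card_gt_0_iff)
  ultimately show ?thesis
    using assms(1,2) by (simp only: sum_u_vec_mult inner) (simp add: sum_subtractf Int_absorb2)
qed

text \<open>
  The constant \<open>card C - 1\<close> on the left cancels the contribution of the \<open>1\<close> in the definition of
  \<open>c\<close>, so that only the superset sums of \<open>u\<close> remain.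
\<close>

lemma cluster_sum_c:
  assumes "finite N" "C \<subseteq> N" "C \<noteq> {}"
  shows "real (card C) - 1 - (\<Sum>S | S \<subseteq> C \<and> card S \<ge> 2. c_vec N u S * (- 1) ^ card S) =
    (\<Sum>T\<in>Pow N. u T * real (card (C \<inter> T) - 1))"
proof -
  have fC: "finite C" using assms finite_subset by blast
  let ?X = "{S. S \<subseteq> C \<and> card S \<ge> 2}"
  have fX: "finite ?X" using fC by simp
  have "card C \<ge> 1"
    using \<open>C \<noteq> {}\<close> fC by (simp add: Suc_le_eq card_gt_0_iff)
  then have "(\<Sum>S\<in>?X. (- 1) ^ card S) = real (card C) - 1"
    using alternating_sum_card_ge_2[OF fC] by simp
  then have "real (card C) - 1 - (\<Sum>S\<in>?X. c_vec N u S * (- 1) ^ card S) =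
      (\<Sum>S\<in>?X. (\<Sum>T | S \<subseteq> T \<and> T \<subseteq> N. u T) * (- 1) ^ card S)"
    by (simp add: c_vec_def left_diff_distrib sum_subtractf)
  also have "\<dots> = (\<Sum>S\<in>?X. \<Sum>T | T \<in> Pow N \<and> S \<subseteq> T. u T * (- 1) ^ card S)"
    by (simp add: sum_distrib_right conj_commute)
  also have "\<dots> = (\<Sum>T\<in>Pow N. \<Sum>S | S \<in> ?X \<and> S \<subseteq> T. u T * (- 1) ^ card S)"
    by (rule sum.swap_restrict) (use assms(1) fX in auto)
  also have "\<dots> = (\<Sum>T\<in>Pow N. u T * real (card (C \<inter> T) - 1))"
  proof (rule sum.cong[OF refl])
    fix T
    have "{S. S \<in> ?X \<and> S \<subseteq> T} = {S. S \<subseteq> C \<inter> T \<and> card S \<ge> 2}" by auto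
    then show "(\<Sum>S | S \<in> ?X \<and> S \<subseteq> T. u T * (- 1) ^ card S) = u T * real (card (C \<inter> T) - 1)"
      using alternating_sum_card_ge_2[of "C \<inter> T"] fC
      by (simp add: sum_distrib_left[symmetric])
  qed
  finally show ?thesis .
qed

theorem lemma16:
  fixes N :: "'a set" and \<eta> :: "'a \<Rightarrow> 'a set \<Rightarrow> real" and u c :: "'a set \<Rightarrow> real"
  assumes "finite N" and "card N \<ge> 2"
    and "\<forall>j\<in>N. (\<Sum>B\<in>Pow (N - {j}). \<eta> j B) = 1"
    and "u = u_vec N \<eta>" and "c = c_vec N u"
  shows "\<forall>C. C \<subseteq> N \<and> card C \<ge> 2 \<longrightarrow>
     (1 \<le> (\<Sum>i\<in>C. \<Sum>B | B \<subseteq> N - {i} \<and> B \<inter> C = {}. \<eta> i B) \<longleftrightarrow>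
        (\<Sum>T | T \<subseteq> N \<and> card (C \<inter> T) \<ge> 2. u T * (real (card (C \<inter> T)) - 1)) \<ge> 0) \<and>
     (1 \<le> (\<Sum>i\<in>C. \<Sum>B | B \<subseteq> N - {i} \<and> B \<inter> C = {}. \<eta> i B) \<longleftrightarrow>
        real (card C) - 1 - (\<Sum>S | S \<subseteq> C \<and> card S \<ge> 2. c S * (- 1) ^ card S) \<ge> 0)"
proof (intro allI impI)
  fix C
  assume C: "C \<subseteq> N \<and> card C \<ge> 2"
  then have "C \<noteq> {}" by auto
  let ?rhs = "\<Sum>i\<in>C. \<Sum>B | B \<subseteq> N - {i} \<and> B \<inter> C = {}. \<eta> i B"
  let ?w = "\<Sum>T\<in>Pow N. u T * real (card (C \<inter> T) - 1)"
  have eta: "?w = ?rhs - 1"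
    using cluster_sum_u[of N C \<eta>] C \<open>C \<noteq> {}\<close> assms by auto
  \<comment> \<open>The truncated weight vanishes on the sets \<open>T\<close> that meet \<open>C\<close> in at most one element.\<close>
  have "(\<Sum>T | T \<subseteq> N \<and> card (C \<inter> T) \<ge> 2. u T * (real (card (C \<inter> T)) - 1)) =
      (\<Sum>T | T \<subseteq> N \<and> card (C \<inter> T) \<ge> 2. u T * real (card (C \<inter> T) - 1))"
    by (rule sum.cong) auto
  also have "\<dots> = ?w"
    using assms(1) by (intro sum.mono_neutral_left) auto
  finally have u: "(\<Sum>T | T \<subseteq> N \<and> card (C \<inter> T) \<ge> 2. u T * (real (card (C \<inter> T)) - 1)) = ?w" .
  have c: "real (card C) - 1 - (\<Sum>S | S \<subseteq> C \<and> card S \<ge> 2. c S * (- 1) ^ card S) = ?w"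
    using cluster_sum_c[of N C u] C \<open>C \<noteq> {}\<close> assms by simp
  show "(1 \<le> ?rhs \<longleftrightarrow>
        (\<Sum>T | T \<subseteq> N \<and> card (C \<inter> T) \<ge> 2. u T * (real (card (C \<inter> T)) - 1)) \<ge> 0) \<and>
     (1 \<le> ?rhs \<longleftrightarrow>
        real (card C) - 1 - (\<Sum>S | S \<subseteq> C \<and> card S \<ge> 2. c S * (- 1) ^ card S) \<ge> 0)"
    unfolding u c eta by simp
qed

end
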